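(* Let $\mu:\mathfrak{h}\to\mathfrak{g}$ be a crossed module of finite-dimensional complex Lie algebras. Then the $2$-cochain $c\in C^2(\mathfrak{h}\rtimes\mathfrak{g},\mathfrak{h}\rtimes\mathfrak{g})$ defined by $$c((h,g),(h',g')):=(0,\mu([h,h']))$$ is a $2$-cocycle.
   Context: A crossed module of Lie algebras is a Lie algebra homomorphism $\mu:\mathfrak{h}\to\mathfrak{g}$ together with an action of $\mathfrak{g}$ on $\mathfrak{h}$ by derivations, written $g\cdot h$, such that for all $g\in\mathfrak{g}$ and $h,h'\in\mathfrak{h}$: (a) $\mu(g\cdot h)=[g,\mu(h)]$, and (b) $\mu(h)\cdot h'=[h,h']$. The semi-direct product $\mathfrak{h}\rtimes\mathfrak{g}$ is the vector space $\mathfrak{h}\oplus\mathfrak{g}$ with bracket $[(h,g),(h',g')]=(g\cdot h'-g'\cdot h,[g,g'])$; here $\mathfrak{h}$ is viewed as a $\mathfrak{g}$-module and as an abelian Lie algebra. In the formula for $c$, $[h,h']$ is the original bracket of $\mathfrak{h}$. $C^2(\mathfrak{l},\mathfrak{l})$ denotes Chevalley-Eilenberg $2$-cochains of the Lie algebra $\mathfrak{l}$ with values in its adjoint representation. *)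

theory Defs
  imports "HOL-Analysis.Product_Vector"
begin

definition bilinear_map ::
  "('k::field \<Rightarrow> 'a::ab_group_add \<Rightarrow> 'a) \<Rightarrow> ('k \<Rightarrow> 'b::ab_group_add \<Rightarrow> 'b) \<Rightarrow>
   ('k \<Rightarrow> 'c::ab_group_add \<Rightarrow> 'c) \<Rightarrow> ('a \<Rightarrow> 'b \<Rightarrow> 'c) \<Rightarrow> bool"
  where "bilinear_map s1 s2 s3 f \<longleftrightarrow>
    (\<forall>x. Vector_Spaces.linear s2 s3 (f x)) \<and>
    (\<forall>y. Vector_Spaces.linear s1 s3 (\<lambda>x. f x y))"

locale lie_algebra = vector_space scale
  for scale :: "'k::field \<Rightarrow> 'l::ab_group_add \<Rightarrow> 'l" +
  fixes bracket :: "'l \<Rightarrow> 'l \<Rightarrow> 'l"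
  assumes bracket_bilinear: "bilinear_map scale scale scale bracket"
    and bracket_alternating: "bracket x x = 0"
    and jacobi: "bracket x (bracket y z) + bracket y (bracket z x) + bracket z (bracket x y) = 0"

locale lie_module =
  lie_algebra scale bracket + M: vector_space scaleM
  for scale :: "'k::field \<Rightarrow> 'l::ab_group_add \<Rightarrow> 'l"
    and bracket :: "'l \<Rightarrow> 'l \<Rightarrow> 'l"
    and scaleM :: "'k \<Rightarrow> 'm::ab_group_add \<Rightarrow> 'm" +
  fixes act :: "'l \<Rightarrow> 'm \<Rightarrow> 'm"
  assumes act_bilinear: "bilinear_map scale scaleM scaleM act"
    and act_bracket: "act (bracket x y) m = act x (act y m) - act y (act x m)"
begin

text \<open>The spaces C^2 and Z^2 of Chevalley-Eilenberg cochains and cocycles with values in the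
  module, and the differential from C^2 to C^3.\<close>

definition ce_2cochain :: "('l \<Rightarrow> 'l \<Rightarrow> 'm) \<Rightarrow> bool"
  where "ce_2cochain c \<longleftrightarrow> bilinear_map scale scale scaleM c \<and> (\<forall>x. c x x = 0)"

definition ce_differential2 :: "('l \<Rightarrow> 'l \<Rightarrow> 'm) \<Rightarrow> 'l \<Rightarrow> 'l \<Rightarrow> 'l \<Rightarrow> 'm"
  where "ce_differential2 c x y z =
    act x (c y z) - act y (c x z) + act z (c x y)
    - c (bracket x y) z + c (bracket x z) y - c (bracket y z) x"

definition ce_2cocycle :: "('l \<Rightarrow> 'l \<Rightarrow> 'm) \<Rightarrow> bool"
  where "ce_2cocycle c \<longleftrightarrow> ce_2cochain c \<and> (\<forall>x y z. ce_differential2 c x y z = 0)"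

end

lemma bilinear_mapD:
  assumes "bilinear_map s1 s2 s3 f"
  shows "f (x + x') y = f x y + f x' y" "f x (y + y') = f x y + f x y'"
    "f (s1 r x) y = s3 r (f x y)" "f x (s2 r y) = s3 r (f x y)"
    "f 0 y = 0" "f x 0 = 0" "f (- x) y = - f x y" "f x (- y) = - f x y"
    "f (x - x') y = f x y - f x' y" "f x (y - y') = f x y - f x y'"
proof -
  have "Vector_Spaces.linear s2 s3 (f x)" "Vector_Spaces.linear s1 s3 (\<lambda>x. f x y)"
    using assms by (auto simp: bilinear_map_def)
  then interpret l: Vector_Spaces.linear s2 s3 "f x" + r: Vector_Spaces.linear s1 s3 "\<lambda>x. f x y"
    by auto
  show "f (x + x') y = f x y + f x' y" "f x (y + y') = f x y + f x y'"
    "f (s1 r x) y = s3 r (f x y)" "f x (s2 r y) = s3 r (f x y)"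
    "f 0 y = 0" "f x 0 = 0" "f (- x) y = - f x y" "f x (- y) = - f x y"
    "f (x - x') y = f x y - f x' y" "f x (y - y') = f x y - f x y'"
    by (fact l.add l.scale l.zero l.neg l.diff r.add r.scale r.zero r.neg r.diff)+
qed

lemma bilinear_mapI:
  assumes "vector_space s1" "vector_space s2" "vector_space s3"
    and "\<And>x x' y. f (x + x') y = f x y + f x' y" "\<And>x y y'. f x (y + y') = f x y + f x y'"
    and "\<And>r x y. f (s1 r x) y = s3 r (f x y)" "\<And>r x y. f x (s2 r y) = s3 r (f x y)"
  shows "bilinear_map s1 s2 s3 f"
  using assms unfolding bilinear_map_def module_hom_iff_linear[symmetric]
  by (simp add: module_hom_def module_hom_axioms_def module_iff_vector_space)

context lie_algebra
begin

lemma bracket_skew: "bracket x y = - bracket y x"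
proof -
  note add = bilinear_mapD(1,2)[OF bracket_bilinear]
  have "bracket x y + bracket y x = bracket (x + y) (x + y) - bracket x x - bracket y y"
    unfolding add by (simp add: algebra_simps)
  then have "bracket x y + bracket y x = 0"
    by (simp add: bracket_alternating)
  then show ?thesis by (simp add: eq_neg_iff_add_eq_0)
qed

lemma adjoint_lie_module: "lie_module scale bracket scale bracket"
proof unfold_locales
  show "bilinear_map scale scale scale bracket" by (rule bracket_bilinear)
  fix x y m
  have "bracket y (bracket m x) = - bracket y (bracket x m)"
    using bracket_skew[of m x] by (simp add: bilinear_mapD[OF bracket_bilinear])
  with jacobi[of x y m] have "bracket m (bracket x y) = bracket y (bracket x m) - bracket x (bracket y m)"
    by (simp add: add_eq_0_iff algebra_simps)
  with bracket_skew[of "bracket x y" m]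
  show "bracket (bracket x y) m = bracket x (bracket y m) - bracket y (bracket x m)"
    by simp
qed

end

locale lie_crossed_module =
  H: lie_algebra scaleh brackh + lie_module scaleg brackg scaleh act
  for scaleh :: "'k::field \<Rightarrow> 'h::ab_group_add \<Rightarrow> 'h"
    and brackh :: "'h \<Rightarrow> 'h \<Rightarrow> 'h"
    and scaleg :: "'k \<Rightarrow> 'g::ab_group_add \<Rightarrow> 'g"
    and brackg :: "'g \<Rightarrow> 'g \<Rightarrow> 'g"
    and act :: "'g \<Rightarrow> 'h \<Rightarrow> 'h" +
  fixes mu :: "'h \<Rightarrow> 'g"
  assumes mu_linear: "Vector_Spaces.linear scaleh scaleg mu"
    and mu_bracket: "mu (brackh h h') = brackg (mu h) (mu h')"
    and act_derivation: "act g (brackh h h') = brackh (act g h) h' + brackh h (act g h')"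
    and mu_equivariant: "mu (act g h) = brackg g (mu h)"
    and peiffer: "act (mu h) h' = brackh h h'"

text \<open>The semi-direct product forgets any bracket on the first factor, which only enters as a
  module (an abelian Lie algebra).\<close>

abbreviation semidirect_scale ::
  "('k::field \<Rightarrow> 'h::ab_group_add \<Rightarrow> 'h) \<Rightarrow> ('k \<Rightarrow> 'g::ab_group_add \<Rightarrow> 'g) \<Rightarrow>
   'k \<Rightarrow> 'h \<times> 'g \<Rightarrow> 'h \<times> 'g"
  where "semidirect_scale \<equiv> module_prod.scale"

definition semidirect_bracket ::
  "('g \<Rightarrow> 'g \<Rightarrow> 'g) \<Rightarrow> ('g \<Rightarrow> 'h::ab_group_add \<Rightarrow> 'h) \<Rightarrow> 'h \<times> 'g \<Rightarrow> 'h \<times> 'g \<Rightarrow> 'h \<times> 'g"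
  where "semidirect_bracket brackg act =
    (\<lambda>(h, g) (h', g'). (act g h' - act g' h, brackg g g'))"

lemma (in lie_module) semidirect_lie_algebra:
  "lie_algebra (semidirect_scale scaleM scale) (semidirect_bracket bracket act)"
proof -
  interpret P: vector_space_prod scaleM scale by unfold_locales
  note simps = semidirect_bracket_def P.scale_def bilinear_mapD[OF bracket_bilinear]
    bilinear_mapD[OF act_bilinear] act_bracket
  show ?thesis
  proof unfold_locales
    show "bilinear_map P.scale P.scale P.scale (semidirect_bracket bracket act)"
      by (rule bilinear_mapI)
        (unfold_locales, auto simp: simps M.scale_right_diff_distrib)
    show "semidirect_bracket bracket act x x = 0" for x
      by (cases x) (simp add: simps bracket_alternating zero_prod_def)
    show "semidirect_bracket bracket act x (semidirect_bracket bracket act y z)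
      + semidirect_bracket bracket act y (semidirect_bracket bracket act z x)
      + semidirect_bracket bracket act z (semidirect_bracket bracket act x y) = 0" for x y z
      by (cases x; cases y; cases z) (simp add: simps jacobi zero_prod_def)
  qed
qed

end

theory Submission
  imports Defs
begin

text \<open>Write \<open>x = (h, g)\<close> and let \<open>c\<close> be the cochain \<open>((h, g), (h', g')) \<mapsto> (0, \<mu> [h, h'])\<close>. Its
  differential splits into two components, which vanish for different reasons.

  In the \<open>\<hh>\<close>-component only the three terms \<open>[x, c y z]\<close> contribute, since \<open>c\<close> takes values in
  \<open>0 \<oplus> \<gg>\<close>. Such a term is \<open>- \<mu> [h', h''] \<cdot> h\<close>, which the Peiffer identity turns
  into \<open>- [[h', h''], h]\<close>; the alternating sum is the Jacobi identity of \<open>\<hh>\<close>.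

  The \<open>\<gg>\<close>-component depends on the \<open>g\<close>'s linearly: the terms containing a given \<open>g\<close> are, up
  to a common sign, \<open>[g, \<mu> [h', h'']] - \<mu> [g \<cdot> h', h''] + \<mu> [g \<cdot> h'', h']\<close>. Equivariance
  of \<open>\<mu>\<close> moves the bracket with \<open>g\<close> inside \<open>\<mu>\<close>, and what is left says exactly that \<open>g\<close> acts by a derivation.\<close>

context lie_crossed_module
begin

definition bracket_cochain :: "'h \<times> 'g \<Rightarrow> 'h \<times> 'g \<Rightarrow> 'h \<times> 'g"
  where "bracket_cochain = (\<lambda>(h, g) (h', g'). (0, mu (brackh h h')))"

text \<open>The Peiffer identity turns this sum into the Jacobi identity of \<open>\<hh>\<close>; it accounts for the
  \<open>\<hh>\<close>-component of the differential.\<close>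

lemma act_mu_bracket_cyclic_sum:
  "act (mu (brackh x y)) z + act (mu (brackh y z)) x + act (mu (brackh z x)) y = 0"
proof -
  have "brackh (brackh x y) z + brackh (brackh y z) x + brackh (brackh z x) y
      = - (brackh x (brackh y z) + brackh y (brackh z x) + brackh z (brackh x y))"
    using H.bracket_skew[of "brackh x y" z] H.bracket_skew[of "brackh y z" x]
      H.bracket_skew[of "brackh z x" y] by (simp add: algebra_simps)
  then show ?thesis by (simp add: peiffer H.jacobi)
qed

text \<open>The derivation property of the action, transported to \<open>\<gg>\<close> by the equivariance of \<open>\<mu>\<close>. The two
  terms on the right have the shape in which \<open>g\<close> enters the terms \<open>c [x, y] z\<close> of the
  differential, so rewriting with this equation cancels its whole \<open>\<gg>\<close>-component.\<close>

lemma brackg_mu_bracket: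
  "brackg g (mu (brackh x y)) = mu (brackh (act g x) y) - mu (brackh (act g y) x)"
proof -
  interpret mu: Vector_Spaces.linear scaleh scaleg mu by (rule mu_linear)
  have "brackg g (mu (brackh x y)) = mu (act g (brackh x y))"
    by (simp add: mu_equivariant)
  also have "act g (brackh x y) = brackh (act g x) y - brackh (act g y) x"
    using H.bracket_skew[of x "act g y"] by (simp add: act_derivation)
  finally show ?thesis by (simp add: mu.diff)
qed

lemma bracket_cochain_bilinear:
  "bilinear_map (semidirect_scale scaleh scaleg) (semidirect_scale scaleh scaleg)
    (semidirect_scale scaleh scaleg) bracket_cochain"
proof -
  interpret mu: Vector_Spaces.linear scaleh scaleg mu by (rule mu_linear)
  interpret P: vector_space_prod scaleh scaleg by unfold_locales
  show ?thesis
    by (rule bilinear_mapI)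
      (unfold_locales, auto simp: bracket_cochain_def P.scale_def
        bilinear_mapD[OF H.bracket_bilinear] mu.add mu.scale)
qed

lemma bracket_cochain_ce_2cocycle:
  "lie_module.ce_2cocycle
    (semidirect_scale scaleh scaleg) (semidirect_bracket brackg act)
    (semidirect_scale scaleh scaleg) (semidirect_bracket brackg act) bracket_cochain"
proof -
  interpret mu: Vector_Spaces.linear scaleh scaleg mu by (rule mu_linear)
  interpret S: lie_algebra "semidirect_scale scaleh scaleg" "semidirect_bracket brackg act"
    by (rule semidirect_lie_algebra)
  interpret A: lie_module "semidirect_scale scaleh scaleg" "semidirect_bracket brackg act"
      "semidirect_scale scaleh scaleg" "semidirect_bracket brackg act"
    by (rule S.adjoint_lie_module)
  have "A.ce_differential2 bracket_cochain x y z = 0" for x y z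
  proof (cases x; cases y; cases z)
    fix h1 g1 h2 g2 h3 g3
    assume xyz: "x = (h1, g1)" "y = (h2, g2)" "z = (h3, g3)"
    have "act (mu (brackh h1 h3)) h2 = - act (mu (brackh h3 h1)) h2"
      using H.bracket_skew[of h1 h3]
      by (simp add: mu.neg bilinear_mapD[OF act_bilinear])
    then have "- act (mu (brackh h2 h3)) h1 + act (mu (brackh h1 h3)) h2 - act (mu (brackh h1 h2)) h3
        = - (act (mu (brackh h1 h2)) h3 + act (mu (brackh h2 h3)) h1 + act (mu (brackh h3 h1)) h2)"
      by (simp add: algebra_simps)
    also have "\<dots> = 0" by (simp add: act_mu_bracket_cyclic_sum)
    finally have h_component:
      "- act (mu (brackh h2 h3)) h1 + act (mu (brackh h1 h3)) h2 - act (mu (brackh h1 h2)) h3 = 0" .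
    show "A.ce_differential2 bracket_cochain x y z = 0"
      using h_component unfolding A.ce_differential2_def
      by (simp add: xyz bracket_cochain_def semidirect_bracket_def
          bilinear_mapD[OF act_bilinear] bilinear_mapD[OF H.bracket_bilinear]
          brackg_mu_bracket mu.diff zero_prod_def)
  qed
  moreover have "bracket_cochain x x = 0" for x
    by (cases x) (simp add: bracket_cochain_def H.bracket_alternating mu.zero zero_prod_def)
  ultimately show ?thesis
    by (simp add: A.ce_2cocycle_def A.ce_2cochain_def bracket_cochain_bilinear)
qed

end

theorem proposition3p2:
  fixes scaleh :: "complex \<Rightarrow> 'h::ab_group_add \<Rightarrow> 'h"
    and brackh :: "'h \<Rightarrow> 'h \<Rightarrow> 'h"
    and scaleg :: "complex \<Rightarrow> 'g::ab_group_add \<Rightarrow> 'g"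
    and brackg :: "'g \<Rightarrow> 'g \<Rightarrow> 'g"
    and act :: "'g \<Rightarrow> 'h \<Rightarrow> 'h"
    and mu :: "'h \<Rightarrow> 'g"
  assumes "lie_crossed_module scaleh brackh scaleg brackg act mu"
    and "\<exists>B. finite_dimensional_vector_space scaleh B"
    and "\<exists>B. finite_dimensional_vector_space scaleg B"
  shows "lie_module.ce_2cocycle
    (semidirect_scale scaleh scaleg) (semidirect_bracket brackg act)
    (semidirect_scale scaleh scaleg) (semidirect_bracket brackg act)
    (\<lambda>(h, g) (h', g'). (0, mu (brackh h h')))"
  using lie_crossed_module.bracket_cochain_ce_2cocycle[OF assms(1)]
  by (simp only: lie_crossed_module.bracket_cochain_def[OF assms(1)])

end
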